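(* Let $S\equiv(S,I,\mathbf d,\mathbf r,\cdot)$ be a partial semigroup, let $i,j\in I$, and suppose $a\in S_{ji}$ is right-invertible. (i) The sandwich semigroup $S_{ij}^a$ has a maximum $\mathscr J^a$-class, and this contains $\operatorname{RI}(a)$. (ii) If $S_{ij}^a$ is stable, then the maximum $\mathscr J^a$-class of $S_{ij}^a$ is in fact an $\mathscr L^a$-class, and is a left-group with set of idempotents $\operatorname{RI}(a)$.
   Context: A partial semigroup $(S,I,\mathbf d,\mathbf r,\cdot)$ consists of sets $S,I$, maps $\mathbf d,\mathbf r:S\to I$ and a partial binary operation on $S$ such that: $x\cdot y$ is defined iff $\mathbf r(x)=\mathbf d(y)$, in which case $\mathbf d(xy)=\mathbf d(x)$ and $\mathbf r(xy)=\mathbf r(y)$; and $(xy)z=x(yz)$ whenever $xy$ and $yz$ are defined. $S_{ij}=\{x\in S:\mathbf d(x)=i,\ \mathbf r(x)=j\}$. For $a\in S_{ji}$, the sandwich semigroup $S_{ij}^a$ is the set $S_{ij}$ with the associative operation $x\star_ay=xay$. The element $a\in S_{ji}$ is right-invertible if there exists $b\in S_{ij}$ such that $x=xab$ for all $x\in S_{ij}$; such an element $b$ is called a right-inverse of $a$, and $\operatorname{RI}(a)$ is the set of all right-inverses of $a$. $\mathscr J^a$ and $\mathscr L^a$ are Green's $\mathscr J$ and $\mathscr L$ relations of the semigroup $S_{ij}^a$; $\mathscr J^a$-classes are ordered by $J_x^a\le J_y^a$ iff $x$ belongs to the principal two-sided ideal of $S_{ij}^a$ generated by $y$, and "maximum"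 refers to this order. A semigroup $T$ is stable if for all $x,u\in T$: $x\,\mathscr J\,xu\Rightarrow x\,\mathscr R\,xu$, and $x\,\mathscr J\,ux\Rightarrow x\,\mathscr L\,ux$. A left-group is a semigroup isomorphic to a direct product of a left-zero semigroup (multiplication $uv=u$) and a group. *)

theory Defs
  imports "HOL-Algebra.Group"
begin

section \<open>Semigroups on a carrier set\<close>

text \<open>A semigroup is given by a carrier set and a binary operation, of which only the values on the
  carrier matter.\<close>

definition semigroup_on :: "'a set \<Rightarrow> ('a \<Rightarrow> 'a \<Rightarrow> 'a) \<Rightarrow> bool" where
  "semigroup_on T f \<longleftrightarrow>
     (\<forall>x\<in>T. \<forall>y\<in>T. f x y \<in> T) \<and>
     (\<forall>x\<in>T. \<forall>y\<in>T. \<forall>z\<in>T. f (f x y) z = f x (f y z))"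

text \<open>The principal ideals \<open>T\<^sup>1x\<close>, \<open>xT\<^sup>1\<close> and \<open>T\<^sup>1xT\<^sup>1\<close>, without an explicit adjoined identity.\<close>

definition left_ideal :: "'a set \<Rightarrow> ('a \<Rightarrow> 'a \<Rightarrow> 'a) \<Rightarrow> 'a \<Rightarrow> 'a set" where
  "left_ideal T f x = {x} \<union> {f s x | s. s \<in> T}"

definition right_ideal :: "'a set \<Rightarrow> ('a \<Rightarrow> 'a \<Rightarrow> 'a) \<Rightarrow> 'a \<Rightarrow> 'a set" where
  "right_ideal T f x = {x} \<union> {f x s | s. s \<in> T}"

definition two_sided_ideal :: "'a set \<Rightarrow> ('a \<Rightarrow> 'a \<Rightarrow> 'a) \<Rightarrow> 'a \<Rightarrow> 'a set" where
  "two_sided_ideal T f x =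
     {x} \<union> {f s x | s. s \<in> T} \<union> {f x t | t. t \<in> T} \<union> {f (f s x) t | s t. s \<in> T \<and> t \<in> T}"

definition green_L :: "'a set \<Rightarrow> ('a \<Rightarrow> 'a \<Rightarrow> 'a) \<Rightarrow> 'a rel" where
  "green_L T f = {(x, y) \<in> T \<times> T. left_ideal T f x = left_ideal T f y}"

definition green_R :: "'a set \<Rightarrow> ('a \<Rightarrow> 'a \<Rightarrow> 'a) \<Rightarrow> 'a rel" where
  "green_R T f = {(x, y) \<in> T \<times> T. right_ideal T f x = right_ideal T f y}"

definition green_J :: "'a set \<Rightarrow> ('a \<Rightarrow> 'a \<Rightarrow> 'a) \<Rightarrow> 'a rel" where
  "green_J T f = {(x, y) \<in> T \<times> T. two_sided_ideal T f x = two_sided_ideal T f y}"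

definition J_class_le :: "'a set \<Rightarrow> ('a \<Rightarrow> 'a \<Rightarrow> 'a) \<Rightarrow> 'a set \<Rightarrow> 'a set \<Rightarrow> bool" where
  "J_class_le T f C D \<longleftrightarrow>
     (\<exists>x\<in>T. \<exists>y\<in>T. C = green_J T f `` {x} \<and> D = green_J T f `` {y} \<and> x \<in> two_sided_ideal T f y)"

definition maximum_J_class :: "'a set \<Rightarrow> ('a \<Rightarrow> 'a \<Rightarrow> 'a) \<Rightarrow> 'a set \<Rightarrow> bool" where
  "maximum_J_class T f M \<longleftrightarrow>
     M \<in> T // green_J T f \<and> (\<forall>C \<in> T // green_J T f. J_class_le T f C M)"

definition stable_semigroup :: "'a set \<Rightarrow> ('a \<Rightarrow> 'a \<Rightarrow> 'a) \<Rightarrow> bool" where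
  "stable_semigroup T f \<longleftrightarrow>
     (\<forall>x\<in>T. \<forall>u\<in>T.
        ((x, f x u) \<in> green_J T f \<longrightarrow> (x, f x u) \<in> green_R T f) \<and>
        ((x, f u x) \<in> green_J T f \<longrightarrow> (x, f u x) \<in> green_L T f))"

definition idempotents :: "'a set \<Rightarrow> ('a \<Rightarrow> 'a \<Rightarrow> 'a) \<Rightarrow> 'a set" where
  "idempotents T f = {e \<in> T. f e e = e}"

definition left_zero :: "'a set \<Rightarrow> ('a \<Rightarrow> 'a \<Rightarrow> 'a) \<Rightarrow> bool" where
  "left_zero T f \<longleftrightarrow> T \<noteq> {} \<and> (\<forall>u\<in>T. \<forall>v\<in>T. f u v = u)"

definition semigroup_iso ::
    "('a \<Rightarrow> 'b) \<Rightarrow> 'a set \<Rightarrow> ('a \<Rightarrow> 'a \<Rightarrow> 'a) \<Rightarrow> 'b set \<Rightarrow> ('b \<Rightarrow> 'b \<Rightarrow> 'b) \<Rightarrow> bool" where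
  "semigroup_iso \<phi> T f U g \<longleftrightarrow>
     bij_betw \<phi> T U \<and> (\<forall>x\<in>T. \<forall>y\<in>T. \<phi> (f x y) = g (\<phi> x) (\<phi> y))"

definition prod_op :: "('a \<Rightarrow> 'a \<Rightarrow> 'a) \<Rightarrow> ('b \<Rightarrow> 'b \<Rightarrow> 'b) \<Rightarrow> 'a \<times> 'b \<Rightarrow> 'a \<times> 'b \<Rightarrow> 'a \<times> 'b" where
  "prod_op f g = (\<lambda>(u, x) (v, y). (f u v, g x y))"

text \<open>HOL cannot quantify over types inside a formula, so the two factors are taken on the type of
  \<open>T\<close> itself. Nothing is lost: both factors embed in their product. The lemma \<open>left_groupI\<close>
  accepts factors on arbitrary types.\<close>

definition left_group :: "'a set \<Rightarrow> ('a \<Rightarrow> 'a \<Rightarrow> 'a) \<Rightarrow> bool" where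
  "left_group T f \<longleftrightarrow>
     semigroup_on T f \<and>
     (\<exists>(L :: 'a set) l (G :: 'a monoid) \<phi>.
        left_zero L l \<and> group G \<and>
        semigroup_iso \<phi> T f (L \<times> carrier G) (prod_op l (mult G)))"

lemma left_groupI:
  fixes T :: "'a set" and L :: "'b set" and G :: "'c monoid"
  assumes T: "semigroup_on T f" and L: "left_zero L l" and G: "group G"
    and iso: "semigroup_iso \<phi> T f (L \<times> carrier G) (prod_op l (mult G))"
  shows "left_group T f"
proof -
  interpret G: group G by (rule G)
  from L obtain l0 where l0: "l0 \<in> L" by (auto simp: left_zero_def)
  define \<psi> where "\<psi> = inv_into T \<phi>"
  have bij: "bij_betw \<phi> T (L \<times> carrier G)" using iso by (simp add: semigroup_iso_def)
  have bij': "bij_betw \<psi> (L \<times> carrier G) T"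
    unfolding \<psi>_def by (rule bij_betw_inv_into[OF bij])
  define p where "p = (\<lambda>u. \<psi> (u, \<one>\<^bsub>G\<^esub>))"
  define q where "q = (\<lambda>x. \<psi> (l0, x))"
  define p' where "p' = inv_into L p"
  define q' where "q' = inv_into (carrier G) q"
  have inj: "inj_on \<psi> (L \<times> carrier G)" using bij' by (simp add: bij_betw_def)
  have inj_p: "inj_on p L"
    unfolding p_def by (rule inj_onI) (use inj in \<open>auto dest: inj_onD\<close>)
  have inj_q: "inj_on q (carrier G)"
    unfolding q_def by (rule inj_onI) (use inj l0 in \<open>auto dest: inj_onD\<close>)
  have p'p: "p' (p u) = u" if "u \<in> L" for u
    using that inj_p by (simp add: p'_def)
  have q'q: "q' (q x) = x" if "x \<in> carrier G" for x
    using that inj_q by (simp add: q'_def)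
  define H :: "'a monoid" where
    "H = \<lparr>carrier = q ` carrier G, mult = (\<lambda>x y. q (q' x \<otimes>\<^bsub>G\<^esub> q' y)), one = q \<one>\<^bsub>G\<^esub>\<rparr>"
  have H: "group H"
  proof (rule groupI)
    fix x assume "x \<in> carrier H"
    then obtain y where y: "y \<in> carrier G" "x = q y" by (auto simp: H_def)
    then show "\<exists>z\<in>carrier H. z \<otimes>\<^bsub>H\<^esub> x = \<one>\<^bsub>H\<^esub>"
      by (intro bexI[of _ "q (inv\<^bsub>G\<^esub> y)"]) (auto simp: H_def q'q)
  qed (auto simp: H_def q'q G.m_assoc)
  define l' where "l' = (\<lambda>u v. p (l (p' u) (p' v)))"
  have L': "left_zero (p ` L) l'"
    using L by (auto simp: left_zero_def l'_def p'p)
  define \<chi> where "\<chi> = map_prod p q \<circ> \<phi>"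
  have "bij_betw (map_prod p q) (L \<times> carrier G) (p ` L \<times> q ` carrier G)"
    using inj_p inj_q by (intro bij_betwI') (auto simp: inj_on_def)
  then have "bij_betw \<chi> T (p ` L \<times> carrier H)"
    unfolding \<chi>_def H_def using bij by (auto intro: bij_betw_trans)
  moreover have "\<chi> (f x y) = prod_op l' (mult H) (\<chi> x) (\<chi> y)" if "x \<in> T" "y \<in> T" for x y
  proof -
    have "\<phi> x \<in> L \<times> carrier G" "\<phi> y \<in> L \<times> carrier G"
      using bij that by (auto dest: bij_betwE)
    moreover have "\<phi> (f x y) = prod_op l (mult G) (\<phi> x) (\<phi> y)"
      using iso that by (simp add: semigroup_iso_def)
    ultimately show ?thesis
      by (auto simp: \<chi>_def prod_op_def l'_def H_def p'p q'q)
  qed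
  ultimately have "semigroup_iso \<chi> T f (p ` L \<times> carrier H) (prod_op l' (mult H))"
    by (simp add: semigroup_iso_def)
  with T L' H show ?thesis unfolding left_group_def by blast
qed


section \<open>Partial semigroups\<close>

text \<open>The partial operation is represented by a total function \<open>ps_mult\<close>, read as defined
  exactly on the pairs \<open>x, y\<close> of elements with \<open>ps_r S x = ps_d S y\<close>; its other values are
  unconstrained.\<close>

record ('s, 'i) partial_sgrp =
  ps_elems :: "'s set"
  ps_index :: "'i set"
  ps_d :: "'s \<Rightarrow> 'i"
  ps_r :: "'s \<Rightarrow> 'i"
  ps_mult :: "'s \<Rightarrow> 's \<Rightarrow> 's"

locale partial_semigroup =
  fixes S :: "('s, 'i) partial_sgrp"
  assumes d_in: "x \<in> ps_elems S \<Longrightarrow> ps_d S x \<in> ps_index S"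
    and r_in: "x \<in> ps_elems S \<Longrightarrow> ps_r S x \<in> ps_index S"
    and mult_closed:
      "\<lbrakk>x \<in> ps_elems S; y \<in> ps_elems S; ps_r S x = ps_d S y\<rbrakk> \<Longrightarrow> ps_mult S x y \<in> ps_elems S"
    and d_mult:
      "\<lbrakk>x \<in> ps_elems S; y \<in> ps_elems S; ps_r S x = ps_d S y\<rbrakk> \<Longrightarrow> ps_d S (ps_mult S x y) = ps_d S x"
    and r_mult:
      "\<lbrakk>x \<in> ps_elems S; y \<in> ps_elems S; ps_r S x = ps_d S y\<rbrakk> \<Longrightarrow> ps_r S (ps_mult S x y) = ps_r S y"
    and mult_assoc:
      "\<lbrakk>x \<in> ps_elems S; y \<in> ps_elems S; z \<in> ps_elems S; ps_r S x = ps_d S y; ps_r S y = ps_d S z\<rbrakk>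
        \<Longrightarrow> ps_mult S (ps_mult S x y) z = ps_mult S x (ps_mult S y z)"

definition hom_set :: "('s, 'i) partial_sgrp \<Rightarrow> 'i \<Rightarrow> 'i \<Rightarrow> 's set" where
  "hom_set S i j = {x \<in> ps_elems S. ps_d S x = i \<and> ps_r S x = j}"

definition sandwich :: "('s, 'i) partial_sgrp \<Rightarrow> 's \<Rightarrow> 's \<Rightarrow> 's \<Rightarrow> 's" where
  "sandwich S a x y = ps_mult S (ps_mult S x a) y"

text \<open>Below, \<open>a\<close> is meant to lie in \<open>hom_set S j i\<close>.\<close>

definition right_inverses :: "('s, 'i) partial_sgrp \<Rightarrow> 'i \<Rightarrow> 'i \<Rightarrow> 's \<Rightarrow> 's set" where
  "right_inverses S i j a =
     {b \<in> hom_set S i j. \<forall>x \<in> hom_set S i j. x = ps_mult S (ps_mult S x a) b}"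

definition right_invertible :: "('s, 'i) partial_sgrp \<Rightarrow> 'i \<Rightarrow> 'i \<Rightarrow> 's \<Rightarrow> bool" where
  "right_invertible S i j a \<longleftrightarrow> (\<exists>b. b \<in> right_inverses S i j a)"

lemma (in partial_semigroup) semigroup_on_sandwich:
  assumes "a \<in> hom_set S j i"
  shows "semigroup_on (hom_set S i j) (sandwich S a)"
  using assms
  by (auto simp: semigroup_on_def hom_set_def sandwich_def mult_closed d_mult r_mult mult_assoc)

end

theory Submission
  imports Defs
begin

text \<open>A right-inverse of \<open>a\<close> is the same thing as a right identity of the sandwich semigroup, so the
  result is one about an arbitrary semigroup \<open>T\<close> with a right identity \<open>b\<close>. Since \<open>x = xb\<close> for all
  \<open>x\<close>, every element lies in the principal ideal of \<open>b\<close>, so the \<open>J\<close>-class of \<open>b\<close> is the maximum one,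
  and it contains every other right identity \<open>e\<close> because \<open>b = be\<close>.

  Suppose now that \<open>T\<close> is stable. If \<open>x\<close> is \<open>J\<close>-related to \<open>b\<close>, then, as \<open>x = xb\<close>, stability makes
  \<open>x\<close> and \<open>b\<close> even \<open>L\<close>-related. Thus the maximum \<open>J\<close>-class \<open>M\<close> is the \<open>L\<close>-class of \<open>b\<close>, and
  each \<open>x \<in> M\<close> satisfies \<open>sx = b\<close> for some \<open>s\<close>, which is again in \<open>M\<close>
  (\<open>max_class_iff_left_factor\<close>). So \<open>M\<close> is a semigroup with a right identity and with left inverses
  relative to \<open>b\<close>. From this the idempotents of \<open>M\<close> are the right identities of \<open>T\<close>, they form a
  left-zero semigroup \<open>E\<close>, the set \<open>bM\<close> is a group \<open>G\<close>, and \<open>(e, g) \<mapsto> eg\<close> is an isomorphism from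
  \<open>E \<times> G\<close> to \<open>M\<close> (\<open>semigroup_iso_max_class\<close>).\<close>

section \<open>Right identities and isomorphisms\<close>

text \<open>Elements of \<open>T\<close> that act on all of \<open>T\<close> as an identity from the right.\<close>

definition right_identities :: "'a set \<Rightarrow> ('a \<Rightarrow> 'a \<Rightarrow> 'a) \<Rightarrow> 'a set" where
  "right_identities T f = {b \<in> T. \<forall>x\<in>T. f x b = x}"

lemma semigroup_iso_inv_into:
  assumes iso: "semigroup_iso \<psi> U g T f"
    and closed: "\<And>p q. p \<in> U \<Longrightarrow> q \<in> U \<Longrightarrow> g p q \<in> U"
  shows "semigroup_iso (inv_into U \<psi>) T f U g"
proof -
  have bij: "bij_betw \<psi> U T"
    and hom: "\<And>p q. p \<in> U \<Longrightarrow> q \<in> U \<Longrightarrow> \<psi> (g p q) = f (\<psi> p) (\<psi> q)"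
    using iso by (auto simp: semigroup_iso_def)
  have "inv_into U \<psi> (f x y) = g (inv_into U \<psi> x) (inv_into U \<psi> y)"
    if x: "x \<in> T" and y: "y \<in> T" for x y
  proof -
    obtain p q where pq: "p \<in> U" "x = \<psi> p" "q \<in> U" "y = \<psi> q"
      using bij x y unfolding bij_betw_def by blast
    then have "inv_into U \<psi> (f x y) = inv_into U \<psi> (\<psi> (g p q))" by (simp add: hom)
    with pq closed[of p q] show ?thesis
      using bij by (simp add: bij_betw_def)
  qed
  then show ?thesis
    using bij_betw_inv_into[OF bij] by (simp add: semigroup_iso_def)
qed

section \<open>Ideals and Green's \<open>J\<close> relation\<close>

locale carrier_semigroup =
  fixes T :: "'a set" and f :: "'a \<Rightarrow> 'a \<Rightarrow> 'a" (infixl "\<star>" 70)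
  assumes semigroup: "semigroup_on T f"
begin

lemma closed [simp, intro]: "x \<in> T \<Longrightarrow> y \<in> T \<Longrightarrow> x \<star> y \<in> T"
  using semigroup by (simp add: semigroup_on_def)

lemma assoc: "x \<in> T \<Longrightarrow> y \<in> T \<Longrightarrow> z \<in> T \<Longrightarrow> x \<star> y \<star> z = x \<star> (y \<star> z)"
  using semigroup by (simp add: semigroup_on_def)

lemma two_sided_ideal_mono:
  assumes y: "y \<in> T" and x: "x \<in> two_sided_ideal T f y"
  shows "two_sided_ideal T f x \<subseteq> two_sided_ideal T f y"
proof -
  let ?I = "two_sided_ideal T f y"
  have left: "s \<star> z \<in> ?I" if "s \<in> T" "z \<in> ?I" for s z
  proof -
    from \<open>z \<in> ?I\<close> consider "z = y" | s' where "s' \<in> T" "z = s' \<star> y" | t where "t \<in> T" "z = y \<star> t"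
      | s' t where "s' \<in> T" "t \<in> T" "z = s' \<star> y \<star> t"
      unfolding two_sided_ideal_def by blast
    then show ?thesis
    proof cases
      case 1 with that show ?thesis by (auto simp: two_sided_ideal_def)
    next
      case (2 s')
      then have "s \<star> z = s \<star> s' \<star> y" using that y by (simp add: assoc)
      with 2 that show ?thesis unfolding two_sided_ideal_def by blast
    next
      case (3 t)
      then have "s \<star> z = s \<star> y \<star> t" using that y by (simp add: assoc)
      with 3 that show ?thesis unfolding two_sided_ideal_def by blast
    next
      case (4 s' t)
      then have "s \<star> z = s \<star> s' \<star> y \<star> t" using that y by (simp add: assoc)
      with 4 that show ?thesis unfolding two_sided_ideal_def by blast
    qed
  qed
  have right: "z \<star> u \<in> ?I" if "u \<in> T" "z \<in> ?I" for u z
  proof -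
    from \<open>z \<in> ?I\<close> consider "z = y" | s' where "s' \<in> T" "z = s' \<star> y" | t where "t \<in> T" "z = y \<star> t"
      | s' t where "s' \<in> T" "t \<in> T" "z = s' \<star> y \<star> t"
      unfolding two_sided_ideal_def by blast
    then show ?thesis
    proof cases
      case 1 with that show ?thesis by (auto simp: two_sided_ideal_def)
    next
      case (2 s') with that show ?thesis by (auto simp: two_sided_ideal_def)
    next
      case (3 t)
      then have "z \<star> u = y \<star> (t \<star> u)" using that y by (simp add: assoc)
      with 3 that show ?thesis unfolding two_sided_ideal_def by blast
    next
      case (4 s' t)
      then have "z \<star> u = s' \<star> y \<star> (t \<star> u)" using that y by (simp add: assoc)
      with 4 that show ?thesis unfolding two_sided_ideal_def by blast
    qed
  qed
  from left right x show ?thesis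
    unfolding two_sided_ideal_def[of T f x] by blast
qed

lemma green_J_iff:
  assumes "x \<in> T" "y \<in> T"
  shows "(x, y) \<in> green_J T f \<longleftrightarrow> x \<in> two_sided_ideal T f y \<and> y \<in> two_sided_ideal T f x"
proof -
  have "z \<in> two_sided_ideal T f z" for z by (simp add: two_sided_ideal_def)
  then show ?thesis
    using two_sided_ideal_mono[of x y] two_sided_ideal_mono[of y x] assms
    unfolding green_J_def by blast
qed

lemma equiv_green_J: "equiv T (green_J T f)"
  by (auto simp: green_J_def equiv_def refl_on_def sym_def trans_def)

lemma J_class_le_antisym:
  assumes "J_class_le T f C D" "J_class_le T f D C"
  shows "C = D"
proof -
  obtain x y where xy: "x \<in> T" "y \<in> T" "C = green_J T f `` {x}" "D = green_J T f `` {y}"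
    "x \<in> two_sided_ideal T f y"
    using assms(1) unfolding J_class_le_def by blast
  obtain y' x' where xy': "x' \<in> T" "y' \<in> T" "D = green_J T f `` {y'}" "C = green_J T f `` {x'}"
    "y' \<in> two_sided_ideal T f x'"
    using assms(2) unfolding J_class_le_def by blast
  have "(x, x') \<in> green_J T f" "(y, y') \<in> green_J T f"
    using xy xy' eq_equiv_class[OF _ equiv_green_J] by metis+
  then have "two_sided_ideal T f x = two_sided_ideal T f x'"
    "two_sided_ideal T f y = two_sided_ideal T f y'"
    by (auto simp: green_J_def)
  with two_sided_ideal_mono[OF xy(2,5)] two_sided_ideal_mono[OF xy'(1,5)]
  have "(x, y) \<in> green_J T f"
    using xy by (simp add: green_J_def)
  then show ?thesis
    using equiv_class_eq[OF equiv_green_J] xy by simp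
qed

end

section \<open>The maximum \<open>J\<close>-class of a semigroup with a right identity\<close>

locale semigroup_with_right_identity = carrier_semigroup +
  fixes b :: 'a
  assumes b: "b \<in> right_identities T f"
begin

lemma b_in [simp, intro]: "b \<in> T"
  using b by (simp add: right_identities_def)

lemma mult_b [simp]: "x \<in> T \<Longrightarrow> x \<star> b = x"
  using b by (simp add: right_identities_def)

text \<open>The \<open>J\<close>-class of \<open>b\<close>. It is the unique maximum \<open>J\<close>-class (\<open>maximum_J_class_iff\<close>), so it
  does not depend on the choice of \<open>b\<close>.\<close>

definition max_class :: "'a set" where
  "max_class = green_J T f `` {b}"

lemma ideal_b: "x \<in> T \<Longrightarrow> x \<in> two_sided_ideal T f b"
  using mult_b[of x] unfolding two_sided_ideal_def by force

lemma max_class_iff: "x \<in> max_class \<longleftrightarrow> x \<in> T \<and> b \<in> two_sided_ideal T f x"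
proof -
  have "x \<in> max_class \<Longrightarrow> x \<in> T" by (auto simp: max_class_def green_J_def)
  then show ?thesis
    using green_J_iff[of b x] ideal_b[of x] by (auto simp: max_class_def)
qed

lemma maximum_J_class_iff: "maximum_J_class T f M \<longleftrightarrow> M = max_class"
proof -
  have "J_class_le T f C max_class" if "C \<in> T // green_J T f" for C
    using that ideal_b unfolding max_class_def J_class_le_def quotient_def by blast
  moreover have "max_class \<in> T // green_J T f"
    unfolding max_class_def by (rule quotientI) simp
  ultimately have max: "maximum_J_class T f max_class"
    by (simp add: maximum_J_class_def)
  show ?thesis
    using max J_class_le_antisym[of M max_class] unfolding maximum_J_class_def by blast
qed

lemma right_identities_subset_max_class: "right_identities T f \<subseteq> max_class"
proof
  fix e assume e: "e \<in> right_identities T f"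
  then have "e \<in> T" and "b = b \<star> e" by (auto simp: right_identities_def)
  then show "e \<in> max_class"
    by (auto simp: max_class_iff two_sided_ideal_def)
qed

end

section \<open>The left-group structure in the stable case\<close>

locale stable_semigroup_with_right_identity = semigroup_with_right_identity +
  assumes stable: "stable_semigroup T f"
begin

text \<open>Stability is needed only for the inclusion in the \<open>L\<close>-class. It is applied to \<open>b\<close> and
  \<open>xb\<close>, which equals \<open>x\<close>.\<close>

lemma max_class_eq_L_class: "max_class = green_L T f `` {b}"
proof (intro equalityI subsetI)
  fix x assume "x \<in> max_class"
  then have x: "x \<in> T" "(b, x \<star> b) \<in> green_J T f"
    by (auto simp: max_class_def green_J_def)
  then have "(b, x \<star> b) \<in> green_L T f"
    using stable b_in unfolding stable_semigroup_def by blast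
  with x show "x \<in> green_L T f `` {b}" by simp
next
  fix x assume "x \<in> green_L T f `` {b}"
  then have "x \<in> T" "left_ideal T f b = left_ideal T f x" by (auto simp: green_L_def)
  then show "x \<in> max_class"
    by (auto simp: max_class_iff left_ideal_def two_sided_ideal_def)
qed

text \<open>The left factor \<open>s\<close> automatically lies in the maximum class itself, because \<open>sx = b\<close> places
  \<open>b\<close> in the ideal of \<open>s\<close>.\<close>

lemma max_class_iff_left_factor:
  "x \<in> max_class \<longleftrightarrow> x \<in> T \<and> (\<exists>s\<in>max_class. s \<star> x = b)"
proof
  assume x: "x \<in> max_class"
  then have xT: "x \<in> T" and "b \<in> left_ideal T f x"
    by (auto simp: max_class_eq_L_class green_L_def left_ideal_def)
  then have "b = x \<or> (\<exists>s\<in>T. s \<star> x = b)"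
    by (auto simp: left_ideal_def)
  \<comment> \<open>If \<open>x\<close> is \<open>b\<close> itself, then \<open>b\<close> serves as the left factor, since \<open>bb = b\<close>.\<close>
  moreover have "b \<star> x = b" if "b = x"
    using mult_b[OF b_in] that by simp
  ultimately obtain s where s: "s \<in> T" "s \<star> x = b"
    using b_in by blast
  have "s \<in> max_class"
    using s xT by (auto simp: max_class_iff two_sided_ideal_def)
  with s xT show "x \<in> T \<and> (\<exists>s\<in>max_class. s \<star> x = b)" by blast
next
  assume "x \<in> T \<and> (\<exists>s\<in>max_class. s \<star> x = b)"
  then obtain s where "x \<in> T" "s \<in> T" "s \<star> x = b"
    using max_class_iff by blast
  then show "x \<in> max_class"
    unfolding max_class_iff two_sided_ideal_def by blast
qed

lemma max_class_in [simp]: "x \<in> max_class \<Longrightarrow> x \<in> T"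
  by (simp add: max_class_iff)

lemma b_in_max_class [simp]: "b \<in> max_class"
  using right_identities_subset_max_class b by blast

lemma max_class_closed [simp]:
  assumes "x \<in> max_class" "y \<in> max_class"
  shows "x \<star> y \<in> max_class"
proof -
  obtain s t where s: "s \<in> max_class" "s \<star> x = b" and t: "t \<in> max_class" "t \<star> y = b"
    using assms max_class_iff_left_factor by meson
  have "t \<star> s \<star> (x \<star> y) = t \<star> (s \<star> x \<star> y)"
    using assms s(1) t(1) by (simp add: assoc)
  also have "\<dots> = t \<star> b \<star> y"
    using assms t(1) by (simp add: s(2) assoc[symmetric])
  also have "\<dots> = b" using t by simp
  finally have "t \<star> s \<star> (x \<star> y) = b" .
  then have "b \<in> two_sided_ideal T f (x \<star> y)"
    using closed[OF max_class_in[OF t(1)] max_class_in[OF s(1)]]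
    unfolding two_sided_ideal_def by blast
  moreover have "x \<star> y \<in> T" using assms by simp
  ultimately show ?thesis
    unfolding max_class_iff by blast
qed

lemma semigroup_on_max_class: "semigroup_on max_class f"
  by (simp add: semigroup_on_def assoc)

text \<open>An idempotent \<open>e\<close> of the maximum class satisfies \<open>be = (se)e = se = b\<close> for a suitable \<open>s\<close>,
  and hence \<open>xe = (xb)e = x(be) = x\<close> for every \<open>x\<close>.\<close>

lemma idempotents_max_class: "idempotents max_class f = right_identities T f"
proof (intro equalityI subsetI)
  fix e assume "e \<in> idempotents max_class f"
  then have e: "e \<in> max_class" "e \<star> e = e" by (auto simp: idempotents_def)
  then obtain s where s: "s \<in> max_class" "s \<star> e = b"
    using max_class_iff_left_factor by blast
  have b_e: "b \<star> e = b"
    using s e by (metis assoc max_class_in)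
  have "x \<star> e = x" if x: "x \<in> T" for x
  proof -
    have "x \<star> e = x \<star> b \<star> e" using x by simp
    also have "\<dots> = x \<star> (b \<star> e)" using x e by (intro assoc) auto
    finally show ?thesis using x b_e by simp
  qed
  with e show "e \<in> right_identities T f" by (simp add: right_identities_def)
next
  fix e assume e: "e \<in> right_identities T f"
  with right_identities_subset_max_class show "e \<in> idempotents max_class f"
    by (auto simp: idempotents_def right_identities_def)
qed

text \<open>The local monoid \<open>bM\<close> of the maximum class \<open>M\<close>, described as the set of elements fixed by \<open>b\<close>
  on the left.\<close>

definition max_group :: "'a monoid" where
  "max_group = \<lparr>carrier = {x \<in> max_class. b \<star> x = x}, mult = (\<star>), one = b\<rparr>"

text \<open>The left factor of \<open>max_class_iff_left_factor\<close>, multiplied by \<open>b\<close> on the left to bring it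
  into the group. Here \<open>x\<close> itself need not lie in the group.\<close>

lemma left_inverse_in_max_group:
  assumes x: "x \<in> max_class"
  shows "\<exists>y\<in>carrier max_group. y \<star> x = b"
proof -
  obtain s where s: "s \<in> max_class" "s \<star> x = b"
    using x max_class_iff_left_factor by blast
  have "b \<star> s \<star> x = b"
    using s x by (simp add: assoc)
  moreover have "b \<star> s \<in> carrier max_group"
    using s by (simp add: max_group_def assoc[symmetric])
  ultimately show ?thesis by blast
qed

lemma group_max_group: "group max_group"
proof (rule groupI)
  fix x assume "x \<in> carrier max_group"
  then show "\<exists>y\<in>carrier max_group. y \<otimes>\<^bsub>max_group\<^esub> x = \<one>\<^bsub>max_group\<^esub>"
    using left_inverse_in_max_group[of x] by (simp add: max_group_def)
next
  fix x y assume "x \<in> carrier max_group" "y \<in> carrier max_group"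
  then show "x \<otimes>\<^bsub>max_group\<^esub> y \<in> carrier max_group"
    by (simp add: max_group_def assoc[symmetric])
qed (auto simp: max_group_def assoc)

lemma left_zero_right_identities: "left_zero (right_identities T f) f"
  using b by (auto simp: left_zero_def right_identities_def)

text \<open>Right identities cancel inside products, so \<open>(eg)(e'g') = e(gg') = (ee')(gg')\<close>. The group
  component of \<open>x\<close> is recovered as \<open>bx\<close>, and its idempotent component as \<open>xy\<close>, where \<open>y\<close> is the
  left inverse of \<open>x\<close> relative to \<open>b\<close> in the group.\<close>

lemma semigroup_iso_max_class:
  "semigroup_iso (\<lambda>(e, g). e \<star> g) (right_identities T f \<times> carrier max_group)
     (prod_op f (mult max_group)) max_class f"
proof -
  let ?E = "right_identities T f" and ?G = "carrier max_group"
  have E: "e \<in> max_class" "e \<in> T" "\<And>x. x \<in> T \<Longrightarrow> x \<star> e = x" if "e \<in> ?E" for e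
    using that right_identities_subset_max_class by (auto simp: right_identities_def)
  have G: "g \<in> max_class" "g \<in> T" "b \<star> g = g" if "g \<in> ?G" for g
    using that by (auto simp: max_group_def)
  have b_mult: "b \<star> (e \<star> g) = g" if "e \<in> ?E" "g \<in> ?G" for e g
    using E[OF that(1)] G[OF that(2)] by (simp add: assoc[symmetric])
  have inj: "e = e' \<and> g = g'"
    if e: "e \<in> ?E" "e' \<in> ?E" and g: "g \<in> ?G" "g' \<in> ?G" and eq: "e \<star> g = e' \<star> g'" for e e' g g'
  proof -
    have gg': "g = g'" using b_mult e g eq by metis
    interpret group max_group by (rule group_max_group)
    \<comment> \<open>Right multiplication by the inverse of \<open>g\<close> turns \<open>eg\<close> into \<open>eb = e\<close>.\<close>
    obtain h where h: "h \<in> ?G" "g \<star> h = b"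
      using r_inv_ex[OF g(1)] by (auto simp: max_group_def)
    have "e = e \<star> g \<star> h" using E[OF e(1)] G[OF g(1)] G[OF h(1)] h by (simp add: assoc)
    moreover have "e' = e' \<star> g \<star> h" using E[OF e(2)] G[OF g(1)] G[OF h(1)] h by (simp add: assoc)
    ultimately show ?thesis using eq gg' by metis
  qed
  have surj: "\<exists>e\<in>?E. \<exists>g\<in>?G. x = e \<star> g" if x: "x \<in> max_class" for x
  proof -
    obtain y where y: "y \<in> ?G" "y \<star> x = b"
      using left_inverse_in_max_group[OF x] by blast
    have yT: "y \<in> T" "y \<in> max_class" using G[OF y(1)] by auto
    have xT: "x \<in> T" using x by simp
    have xyx: "x \<star> y \<star> x = x" using xT yT y(2) by (simp add: assoc)
    have "x \<star> y \<star> (x \<star> y) = x \<star> y"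
      using xyx xT yT by (metis assoc closed)
    then have "x \<star> y \<in> ?E"
      using x yT idempotents_max_class by (auto simp: idempotents_def)
    moreover have "b \<star> x \<in> ?G"
      using x by (simp add: max_group_def assoc[symmetric])
    moreover have "x = x \<star> y \<star> (b \<star> x)"
      using xyx xT yT by (simp add: assoc[symmetric])
    ultimately show ?thesis by blast
  qed
  have "bij_betw (\<lambda>(e, g). e \<star> g) (?E \<times> ?G) max_class"
    unfolding bij_betw_def
  proof
    show "inj_on (\<lambda>(e, g). e \<star> g) (?E \<times> ?G)"
      using inj by (auto simp: inj_on_def)
    show "(\<lambda>(e, g). e \<star> g) ` (?E \<times> ?G) = max_class"
      using surj E G by (fastforce simp: image_iff)
  qed
  moreover have "e \<star> e' \<star> (g \<star> g') = e \<star> g \<star> (e' \<star> g')"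
    if "e \<in> ?E" "e' \<in> ?E" "g \<in> ?G" "g' \<in> ?G" for e e' g g'
  proof -
    have "e \<star> g \<star> (e' \<star> g') = e \<star> g \<star> e' \<star> g'"
      using E(2)[OF that(1)] E(2)[OF that(2)] G(2)[OF that(3)] G(2)[OF that(4)]
      by (simp only: assoc closed)
    also have "e \<star> g \<star> e' = e \<star> g"
      using E(2)[OF that(1)] G(2)[OF that(3)] by (intro E(3)[OF that(2)] closed)
    also have "\<dots> \<star> g' = e \<star> (g \<star> g')"
      using E(2)[OF that(1)] G(2)[OF that(3)] G(2)[OF that(4)] by (rule assoc)
    finally show ?thesis using E(3)[OF that(2) E(2)[OF that(1)]] by simp
  qed
  ultimately show ?thesis
    by (auto simp: semigroup_iso_def prod_op_def max_group_def)
qed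

lemma max_class_left_group: "left_group max_class f"
proof -
  interpret group max_group by (rule group_max_group)
  have "prod_op f (mult max_group) p q \<in> right_identities T f \<times> carrier max_group"
    if "p \<in> right_identities T f \<times> carrier max_group" "q \<in> right_identities T f \<times> carrier max_group"
    for p q
    using that left_zero_right_identities by (auto simp: prod_op_def left_zero_def)
  from semigroup_iso_inv_into[OF semigroup_iso_max_class this]
  show ?thesis
    by (rule left_groupI[OF semigroup_on_max_class left_zero_right_identities group_max_group])
qed

end

section \<open>Sandwich semigroups\<close>

lemma right_inverses_eq_right_identities:
  "right_inverses S i j a = right_identities (hom_set S i j) (sandwich S a)"
  unfolding right_inverses_def right_identities_def sandwich_def by metis

theorem proposition3p22:
  fixes S :: "('s, 'i) partial_sgrp" and i j :: 'i and a :: 's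
  assumes "partial_semigroup S"
    and "i \<in> ps_index S" and "j \<in> ps_index S"
    and "a \<in> hom_set S j i"
    and "right_invertible S i j a"
  shows "(\<exists>!M. maximum_J_class (hom_set S i j) (sandwich S a) M) \<and>
         (\<forall>M. maximum_J_class (hom_set S i j) (sandwich S a) M \<longrightarrow>
            right_inverses S i j a \<subseteq> M \<and>
            (stable_semigroup (hom_set S i j) (sandwich S a) \<longrightarrow>
               M \<in> hom_set S i j // green_L (hom_set S i j) (sandwich S a) \<and>
               left_group M (sandwich S a) \<and>
               idempotents M (sandwich S a) = right_inverses S i j a))"
proof -
  let ?T = "hom_set S i j" and ?f = "sandwich S a"
  obtain b where b: "b \<in> right_identities ?T ?f"
    using assms(5) by (auto simp: right_invertible_def right_inverses_eq_right_identities)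
  interpret semigroup_with_right_identity ?T ?f b
    using partial_semigroup.semigroup_on_sandwich[OF assms(1,4)] b by unfold_locales
  have "max_class \<in> ?T // green_L ?T ?f \<and> left_group max_class ?f \<and>
      idempotents max_class ?f = right_inverses S i j a"
    if "stable_semigroup ?T ?f"
  proof -
    interpret stable_semigroup_with_right_identity ?T ?f b
      using that by unfold_locales
    have "max_class \<in> ?T // green_L ?T ?f"
      unfolding max_class_eq_L_class by (rule quotientI) simp
    then show ?thesis
      by (simp add: max_class_left_group idempotents_max_class right_inverses_eq_right_identities)
  qed
  then show ?thesis
    using right_identities_subset_max_class
    by (simp add: maximum_J_class_iff right_inverses_eq_right_identities)
qed

end
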